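(* Let $q$ be a prime power and let $n,k$ be positive integers with $n\geq 2k$. Let $\mathcal{A}\subseteq\{1,2,\ldots,k,n-k,\ldots,n-1\}$. If $\mathcal A\cap \{k,n-k\}\neq\emptyset$, then $$A_q(n,\mathcal A)\geq\frac{q^n-q^{k+r}}{q^k-1}+1,$$ where $r\equiv n\pmod k$ and $0\leq r<k$.
   Context: For integers $0<t_1<\cdots<t_s<n$, a flag of type $(t_1,\ldots,t_s)$ on $\mathbb F_q^n$ is a sequence $\mathcal F=(\mathcal F_1,\ldots,\mathcal F_s)$ of subspaces of $\mathbb F_q^n$ with $\dim\mathcal F_i=t_i$ and $\mathcal F_1\subsetneq\cdots\subsetneq\mathcal F_s$. The subspace distance is $d_S(\mathcal U,\mathcal V)=\dim\mathcal U+\dim\mathcal V-2\dim(\mathcal U\cap\mathcal V)$, and the flag distance is $d_f(\mathcal F,\mathcal F')=\sum_{i=1}^{s}d_S(\mathcal F_i,\mathcal F'_i)$. A flag code of type $(t_1,\ldots,t_s)$ is a nonempty set $\mathcal C$ of flags of this type; its minimum distance $d_f(\mathcal C)$ is the minimum of $d_f(\mathcal F,\mathcal F')$ over distinct $\mathcal F,\mathcal F'\in\mathcal C$. One always has $d_f(\mathcal C)\le d_{\max}$, where $$d_{\max}=2\Big(\sum_{t_i\leq \lfloor n/2\rfloor}t_i+\sum_{t_i> \lfloor n/2\rfloor}(n-t_i)\Big).$$ The code $\mathcal C$ is called an $(n,(t_1,\ldots,t_s))_q$ optimum distance flag code (ODFC) if $d_f(\mathcal C)=d_{\max}$. For $\mathcal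 A=\{t_1,\ldots,t_s\}$, $A_q(n,\mathcal A)$ denotes the maximum number of flags in an $(n,(t_1,\ldots,t_s))_q$-ODFC. *)

theory Defs
  imports "HOL-Analysis.Cartesian_Space" "HOL-Number_Theory.Cong"
begin

text \<open>
  The field with \<open>q\<close> elements is a type \<open>'a\<close> of sort \<open>{field, finite}\<close> with \<open>q = CARD('a)\<close>, and its
  \<open>n\<close>-dimensional coordinate space is \<open>'a ^ 'n\<close> with \<open>n = CARD('n)\<close>.
\<close>

definition flag_type :: "nat \<Rightarrow> nat list \<Rightarrow> bool" where
  "flag_type n ts \<longleftrightarrow> sorted_wrt (<) ts \<and> (\<forall>t\<in>set ts. 0 < t \<and> t < n)"

definition is_flag :: "nat list \<Rightarrow> ('a::field ^ 'n) set list \<Rightarrow> bool" where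
  "is_flag ts F \<longleftrightarrow>
     length F = length ts \<and>
     (\<forall>i<length ts. vec.subspace (F ! i) \<and> vec.dim (F ! i) = ts ! i) \<and>
     (\<forall>i. Suc i < length ts \<longrightarrow> F ! i \<subset> F ! Suc i)"

text \<open>The subtraction does not truncate on subspaces.\<close>

definition subspace_dist :: "('a::field ^ 'n) set \<Rightarrow> ('a ^ 'n) set \<Rightarrow> nat" where
  "subspace_dist U V = vec.dim U + vec.dim V - 2 * vec.dim (U \<inter> V)"

text \<open>Only used for two flags of the same type, hence lists of the same length.\<close>

definition flag_dist :: "('a::field ^ 'n) set list \<Rightarrow> ('a ^ 'n) set list \<Rightarrow> nat" where
  "flag_dist F F' = (\<Sum>i<length F. subspace_dist (F ! i) (F' ! i))"

definition is_flag_code :: "nat list \<Rightarrow> ('a::{field,finite} ^ 'n) set list set \<Rightarrow> bool" where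
  "is_flag_code ts C \<longleftrightarrow>
     flag_type CARD('n) ts \<and> C \<noteq> {} \<and> (\<forall>F\<in>C. is_flag ts F)"

text \<open>
  The minimum is over the empty set for a code with a single flag; the value is then \<open>0\<close> by
  convention, so that such a code is never an optimum distance flag code of nonempty type.
\<close>

definition min_flag_dist :: "('a::{field,finite} ^ 'n) set list set \<Rightarrow> nat" where
  "min_flag_dist C =
     (if \<exists>F\<in>C. \<exists>F'\<in>C. F \<noteq> F'
      then Min {flag_dist F F' | F F'. F \<in> C \<and> F' \<in> C \<and> F \<noteq> F'}
      else 0)"

definition max_flag_dist :: "nat \<Rightarrow> nat list \<Rightarrow> nat" where
  "max_flag_dist n ts =
     2 * ((\<Sum>t | t \<in> set ts \<and> t \<le> n div 2. t) + (\<Sum>t | t \<in> set ts \<and> t > n div 2. n - t))"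

definition is_ODFC :: "nat list \<Rightarrow> ('a::{field,finite} ^ 'n) set list set \<Rightarrow> bool" where
  "is_ODFC ts C \<longleftrightarrow> is_flag_code ts C \<and> min_flag_dist C = max_flag_dist CARD('n) ts"

text \<open>
  The number \<open>A\<^sub>q(n, A)\<close>; the two type arguments carry the field and the index type, that is,
  \<open>q\<close> and \<open>n\<close>. The set of cardinalities is finite, and it is nonempty for every nonempty
  set \<open>A\<close> of integers strictly between \<open>0\<close> and \<open>n\<close>.
\<close>

definition max_ODFC_size ::
  "'a::{field,finite} itself \<Rightarrow> 'n::finite itself \<Rightarrow> nat set \<Rightarrow> nat" where
  "max_ODFC_size _ _ A =
     Max {card C | C :: ('a ^ 'n) set list set. is_ODFC (sorted_list_of_set A) C}"

end

theory Submission
  imports Defs "HOL-Algebra.Algebraic_Closure_Type"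
begin

text \<open>
  A flag of the code is obtained from a pair \<open>U \<subseteq> W\<close> of subspaces of dimensions \<open>k\<close> and \<open>n - k\<close>:
  below \<open>k\<close> the flag runs inside \<open>U\<close>, above \<open>n - k\<close> it runs above \<open>W\<close>. The distances are maximal
  in all positions as soon as any two of the subspaces \<open>U\<close> meet trivially and any two of the
  subspaces \<open>W\<close> span the whole space. Such families of pairs are built by induction, from a space
  \<open>L\<close> of dimension \<open>d\<close> to \<open>V = E \<oplus> L\<close> with \<open>dim E = k\<close>. Embed \<open>E\<close> into \<open>L\<close> by \<open>s\<close>, with left
  inverse \<open>p\<close>, and let \<open>g\<close> range over the nonzero multiplications of a field structure with \<open>q\<^sup>d\<close>
  elements on \<open>L\<close>. The new pairs are \<open>U\<^sub>g = {x + g (s x) | x \<in> E}\<close> and \<open>W\<^sub>g = {p y + g y | y \<in> L}\<close>. The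
  pairs \<open>(U, W)\<close> of \<open>L\<close> survive as \<open>(U, E + W)\<close>, except for one of them, which is exchanged for the
  two pairs \<open>(U, L)\<close> and \<open>(E, E + W)\<close>. This exchange gains one pair, so that the total
  gain is \<open>q\<^sup>d\<close>, and it allows \<open>U \<subseteq> W\<close> to fail for the exchanged pair. The induction can therefore
  start in dimension \<open>k + r\<close>, with one arbitrary pair.
\<close>

section \<open>Finite extensions of a finite field\<close>

text \<open>Multiplication by a nonzero \<open>x\<close> permutes the nonzero elements, so their
  product absorbs the factor \<open>x ^ (CARD('a) - 1)\<close>.\<close>

lemma power_card_field_eq_same:
  fixes x :: "'a::{field,finite}"
  shows "x ^ CARD('a) = x"
proof (cases "x = 0")
  case True
  then show ?thesis by simp
next
  case False
  have "(\<Prod>y\<in>UNIV-{0}. x * y) = \<Prod>(UNIV-{0})"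
    by (rule prod.reindex_bij_witness[of _ "\<lambda>y. y / x" "\<lambda>y. x * y"]) (use False in auto)
  then have "x ^ (CARD('a) - 1) * \<Prod>(UNIV-{0::'a}) = \<Prod>(UNIV-{0})"
    by (simp add: prod.distrib)
  then have "x ^ (CARD('a) - 1) = 1"
    by simp
  then show ?thesis
    by (metis Suc_diff_1 mult.right_neutral power_Suc zero_less_card_finite)
qed

lemma card_field_ge_2: "CARD('a::{field,finite}) \<ge> 2"
proof -
  have "card {0, 1::'a} \<le> CARD('a)"
    by (intro card_mono) auto
  then show ?thesis by simp
qed

text \<open>Translation by 1 permutes the field, so the sum of all elements absorbs
  \<open>CARD('a)\<close> copies of 1.\<close>

lemma of_nat_card_field [simp]: "of_nat CARD('a::{field,finite}) = (0::'a)"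
proof -
  have "(\<Sum>x\<in>UNIV. x + 1) = (\<Sum>x\<in>UNIV. x::'a)"
    by (rule sum.reindex_bij_witness[of _ "\<lambda>y. y - 1" "\<lambda>y. y + 1"]) auto
  then show ?thesis
    by (simp add: sum.distrib)
qed

text \<open>
  For fixed \<open>a\<close>, the polynomial \<open>(a + Y)\<^sup>q - a\<^sup>q - Y\<^sup>q\<close> has degree less than \<open>q\<close>, so it
  vanishes as soon as it vanishes at the \<open>q\<close> elements of the ground field. This avoids
  proving that \<open>q\<close> is a power of the characteristic.
\<close>

lemma power_card_field_add:
  fixes x y :: "'a::{field,finite} alg_closure"
  shows "(x + y) ^ CARD('a) = x ^ CARD('a) + y ^ CARD('a)"
proof -
  let ?q = "CARD('a)"
  have extend: "(a + y) ^ ?q = a ^ ?q + y ^ ?q"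
    if "\<And>c::'a. (a + to_ac c) ^ ?q = a ^ ?q + to_ac c ^ ?q" for a y :: "'a alg_closure"
  proof -
    define p where "p = [:a, 1:] ^ ?q - monom 1 ?q - [:a ^ ?q:]"
    have poly_p: "poly p z = (a + z) ^ ?q - z ^ ?q - a ^ ?q" for z
      by (simp add: p_def poly_monom poly_power)
    have "p = 0"
    proof (rule ccontr)
      assume "p \<noteq> 0"
      have deg: "degree ([:a, 1:] ^ ?q) = ?q"
        by (simp add: degree_power_eq)
      have "coeff ([:a, 1:] ^ ?q) ?q = 1"
        using deg lead_coeff_power[of "[:a, 1:]" ?q] by simp
      then have "coeff p i = 0" if "i \<ge> ?q" for i
        using that deg coeff_eq_0[of "[:a, 1:] ^ ?q" i]
        by (cases "i = ?q") (auto simp: p_def coeff_pCons split: nat.split)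
      then have "degree p < ?q"
        using \<open>p \<noteq> 0\<close> by (metis leading_coeff_0_iff not_le)
      moreover have "card (range (to_ac :: 'a \<Rightarrow> _)) \<le> card {z. poly p z = 0}"
        by (intro card_mono poly_roots_finite \<open>p \<noteq> 0\<close>) (auto simp: poly_p that)
      ultimately show False
        using card_poly_roots_bound[OF \<open>p \<noteq> 0\<close>] by (simp add: card_image inj_to_ac)
    qed
    then show ?thesis
      using poly_p[of y] by (simp add: algebra_simps)
  qed
  \<comment> \<open>\<open>extend\<close> is used twice: first with \<open>a\<close> in the ground
    field, where the identity holds because \<open>c ^ ?q = c\<close> there; swapping the summands
    then supplies its hypothesis for arbitrary \<open>a\<close>.\<close>
  have "(a + to_ac c) ^ ?q = a ^ ?q + to_ac c ^ ?q" for a :: "'a alg_closure" and c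
  proof -
    have "(to_ac c + to_ac b) ^ ?q = to_ac c ^ ?q + to_ac b ^ ?q" for b
      by (simp flip: to_ac_add to_ac_power add: power_card_field_eq_same)
    then show ?thesis
      using extend[of "to_ac c" a] by (simp add: add.commute)
  qed
  then show ?thesis
    by (rule extend)
qed

lemma power_card_power_field_add:
  fixes x y :: "'a::{field,finite} alg_closure"
  shows "(x + y) ^ (CARD('a) ^ d) = x ^ (CARD('a) ^ d) + y ^ (CARD('a) ^ d)"
  by (induction d) (simp_all add: power_mult power_card_field_add mult.commute[of "CARD('a)"])

text \<open>The fixed points are the roots of \<open>X ^ m - X\<close> with
  \<open>m = CARD('a) ^ d\<close>. This polynomial splits over the closure and has derivative -1,
  since \<open>m\<close> vanishes in the field. Hence no root is repeated and there are as many
  roots as the degree.\<close>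

lemma card_fixed_points_frobenius:
  assumes "d > 0"
  shows "card {x::'a::{field,finite} alg_closure. x ^ (CARD('a) ^ d) = x} = CARD('a) ^ d"
proof -
  define m where "m = CARD('a) ^ d"
  define p :: "'a alg_closure poly" where "p = monom 1 m - monom 1 1"
  have "2 \<le> CARD('a)" by (rule card_field_ge_2)
  also have "CARD('a) \<le> m"
    unfolding m_def using assms by (intro self_le_power) auto
  finally have m: "m \<ge> 2" .
  have "of_nat m = (0 :: 'a alg_closure)"
    using assms by (simp add: m_def power_0_left flip: to_ac_of_nat)
  then have pderiv: "pderiv p = -1"
    by (simp add: p_def pderiv_diff pderiv_monom monom_0 flip: one_pCons)
  have deg: "degree p = m"
  proof (rule antisym)
    show "degree p \<le> m"
      unfolding p_def using m by (intro degree_diff_le order.trans[OF degree_monom_le]) auto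
    show "m \<le> degree p"
      using m by (intro le_degree) (simp add: p_def)
  qed
  then have "p \<noteq> 0"
    using m by auto
  then obtain A where A: "size A = degree p" "p = smult (lead_coeff p) (\<Prod>x\<in>#A. [:-x, 1:])"
    using alg_closed_imp_factorization by blast
  have roots: "{x. x ^ m = x} = set_mset A"
  proof -
    have "x ^ m = x \<longleftrightarrow> poly p x = 0" for x
      by (simp add: p_def poly_monom)
    moreover have "poly p x = 0 \<longleftrightarrow> x \<in># A" for x
      by (subst A(2)) (use \<open>p \<noteq> 0\<close> in \<open>auto simp: poly_prod_mset prod_mset_zero_iff\<close>)
    ultimately show ?thesis by auto
  qed
  have "count A x \<le> 1" for x
  proof (rule ccontr)
    assume "\<not> count A x \<le> 1"
    then have "{#x, x#} \<subseteq># A"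
      by (simp add: subseteq_mset_def)
    then obtain B where "A = {#x, x#} + B"
      by (metis subset_mset.add_diff_inverse)
    then have "p = [:-x, 1:] * ([:-x, 1:] * smult (lead_coeff p) (\<Prod>x\<in>#B. [:-x, 1:]))"
      by (subst A(2)) (simp add: mult_ac)
    then obtain r where "p = [:-x, 1:] * ([:-x, 1:] * r)"
      by blast
    then have "poly (pderiv p) x = 0"
      by (simp only: pderiv_mult poly_add poly_mult) simp
    then show False
      by (simp add: pderiv)
  qed
  then have "A = mset_set (set_mset A)"
    by (intro multiset_eqI) (metis One_nat_def count_mset_set(1,3) finite_set_mset le_Suc_eq le_zero_eq not_in_iff)
  then have "card (set_mset A) = size A"
    by (metis size_mset_set)
  then show ?thesis
    using A(1) deg roots by (simp add: m_def)
qed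

section \<open>Counting vectors, and field multiplications as linear maps\<close>

lemma (in vector_space) card_span_independent:
  fixes B :: "'b set"
  assumes "independent B" "finite B" "finite (UNIV :: 'a set)"
  shows "card (span B) = CARD('a) ^ card B"
  using assms(2,1)
proof (induction B)
  case empty
  then show ?case by simp
next
  case (insert x B)
  have indep: "independent B" and x: "x \<notin> span B"
    using insert.prems insert.hyps(2) by (auto simp: independent_insert)
  define f where "f = (\<lambda>(c, y). scale c x + y)"
  have "span (insert x B) = f ` (UNIV \<times> span B)"
  proof (intro equalityI subsetI)
    fix z assume "z \<in> span (insert x B)"
    then obtain c where "z - scale c x \<in> span B"
      by (auto simp: span_insert)
    then show "z \<in> f ` (UNIV \<times> span B)"
      by (intro image_eqI[of _ _ "(c, z - scale c x)"]) (auto simp: f_def)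
  next
    fix z assume "z \<in> f ` (UNIV \<times> span B)"
    then obtain c y where "y \<in> span B" "z = scale c x + y"
      by (auto simp: f_def)
    then show "z \<in> span (insert x B)"
      by (auto simp: span_insert intro!: exI[of _ c])
  qed
  moreover have "inj_on f (UNIV \<times> span B)"
  proof (rule inj_onI, clarsimp simp: f_def)
    fix c y c' y' assume y: "y \<in> span B" "y' \<in> span B" and eq: "scale c x + y = scale c' x + y'"
    have "scale (c - c') x = y' - y"
      using eq by (simp add: scale_left_diff_distrib algebra_simps)
    then have "scale (c - c') x \<in> span B"
      using y by (simp add: span_diff)
    then have "scale (inverse (c - c')) (scale (c - c') x) \<in> span B"
      by (rule span_scale)
    then have "c = c'"
      using x by (cases "c = c'") auto
    then show "c = c' \<and> y = y'"
      using eq by simp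
  qed
  ultimately show ?case
    using insert.IH[OF indep] insert.hyps by (simp add: card_image card_cartesian_product)
qed

abbreviation vlinear :: "(('a::field)^'n \<Rightarrow> 'a^'n) \<Rightarrow> bool" where
  "vlinear \<equiv> Vector_Spaces.linear (*s) (*s)"

text \<open>
  The maps are the multiplications by the nonzero elements of a field with
  \<open>q\<^sup>d\<close> elements, carried over to \<open>L\<close>.
\<close>

lemma ex_linear_maps_injective_differences:
  fixes L :: "('a::{field,finite} ^ 'n) set"
  assumes L: "vec.subspace L" and d: "vec.dim L > 0"
  obtains G where "card G = CARD('a) ^ vec.dim L - 1"
    and "\<And>g. g \<in> G \<Longrightarrow> vlinear g"
    and "\<And>g x. g \<in> G \<Longrightarrow> x \<in> L \<Longrightarrow> g x \<in> L"
    and "\<And>g. g \<in> G \<Longrightarrow> inj_on g L"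
    and "\<And>g h. g \<in> G \<Longrightarrow> h \<in> G \<Longrightarrow> g \<noteq> h \<Longrightarrow> inj_on (\<lambda>x. g x - h x) L"
proof -
  \<comment> \<open>The closure is made a vector space over \<open>'a\<close>, so that its subfield
    \<open>K\<close> of order \<open>m\<close> can be compared with \<open>L\<close> by
    dimension.\<close>
  define sc where "sc = (\<lambda>(c::'a) x. to_ac c * x)"
  interpret ac: vector_space sc
    by unfold_locales (auto simp: sc_def algebra_simps)
  interpret P: vector_space_pair "(*s) :: 'a \<Rightarrow> 'a ^ 'n \<Rightarrow> 'a ^ 'n" sc
    by unfold_locales
  define m where "m = CARD('a) ^ vec.dim L"
  define K where "K = {x :: 'a alg_closure. x ^ m = x}"
  have m: "m > 0"
    by (simp add: m_def)
  have cardK: "card K = m"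
    unfolding K_def m_def by (rule card_fixed_points_frobenius[OF d])
  then have finK: "finite K"
    using m by (metis card.infinite less_irrefl)
  have K0: "0 \<in> K"
    using m by (simp add: K_def)
  have K_mult: "x * y \<in> K" if "x \<in> K" "y \<in> K" for x y
    using that by (simp add: K_def power_mult_distrib)
  have "to_ac (c::'a) \<in> K" for c
  proof -
    have "c ^ (CARD('a) ^ e) = c" for e
      by (induction e) (simp_all add: power_mult power_card_field_eq_same)
    then show ?thesis
      by (simp add: K_def m_def flip: to_ac_power)
  qed
  then have "sc c x \<in> K" if "x \<in> K" for c x
    using K_mult that by (simp add: sc_def)
  moreover have "x + y \<in> K" if "x \<in> K" "y \<in> K" for x y
    using that by (simp add: K_def m_def power_card_power_field_add)
  ultimately have K: "ac.subspace K"
    using K0 by (intro ac.subspaceI)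
  obtain B where B: "B \<subseteq> K" "ac.independent B" "K \<subseteq> ac.span B"
    using ac.maximal_independent_subset[of K] by blast
  have finB: "finite B"
    using B(1) finK finite_subset by blast
  have "ac.span B = K"
    using B K by (simp add: ac.span_minimal subset_antisym)
  \<comment> \<open>Counting \<open>K\<close> through a basis gives it the dimension of
    \<open>L\<close>; this yields the linear bijection \<open>f\<close> from \<open>L\<close> to
    \<open>K\<close>, and \<open>T\<close> inverts it.\<close>
  then have "CARD('a) ^ card B = CARD('a) ^ vec.dim L"
    using ac.card_span_independent[OF B(2) finB] cardK by (simp add: m_def)
  then have cardB: "card B = vec.dim L"
    using card_field_ge_2[where 'a = 'a] by (intro power_inject_exp[THEN iffD1]) auto
  then have dimK: "ac.dim K = vec.dim L"
    using B ac.basis_card_eq_dim by metis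
  obtain C where C: "C \<subseteq> L" "vec.independent C" "L \<subseteq> vec.span C" "card C = vec.dim L"
    using vec.basis_exists by blast
  obtain f where f: "Vector_Spaces.linear (*s) sc f" "f ` L = K" "inj_on f L"
    using P.finite_basis_to_basis_subspace_isomorphism[OF L K _ _ C finB B(1,2,3)]
      dimK cardB C(2) vec.finiteI_independent by metis
  obtain T where T: "range T \<subseteq> L" "Vector_Spaces.linear sc (*s) T" "\<And>v. v \<in> L \<Longrightarrow> T (f v) = v"
    using P.linear_exists_left_inverse_on[OF f(1) L f(3)] by blast
  interpret f: Vector_Spaces.linear "(*s)" sc f by fact
  interpret T: Vector_Spaces.linear sc "(*s)" T by fact
  have T_eq_0: "z = 0" if "z \<in> K" "T z = 0" for z
    using that f(2) T(3) by (metis f.zero imageE)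
  have f_eq_0: "y = 0" if "y \<in> L" "f y = 0" for y
    using that T(3) T.zero by metis
  \<comment> \<open>Multiplication by \<open>a\<close>, transported along \<open>f\<close>.
    Differences are again of this form, so both injectivity claims reduce to the absence of zero
    divisors.\<close>
  define g where "g = (\<lambda>a y. T (a * f y))"
  have g_diff: "g a x - g b x = g (a - b) x" for a b x
    by (simp add: g_def T.diff left_diff_distrib)
  have K_diff: "a - b \<in> K" if "a \<in> K" "b \<in> K" for a b
    using that K by (rule ac.subspace_diff[rotated])
  have linear: "vlinear (g a)" for a
    by unfold_locales
      (simp_all add: g_def f.add f.scale T.add distrib_left sc_def mult.left_commute[of a]
        flip: T.scale[unfolded sc_def])
  have inj: "inj_on (g a) L" if "a \<in> K" "a \<noteq> 0" for a
  proof (rule inj_onI)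
    fix x y assume xy: "x \<in> L" "y \<in> L" "g a x = g a y"
    then have "T (a * f (x - y)) = 0"
      by (simp add: g_def f.diff right_diff_distrib T.diff)
    moreover have "x - y \<in> L"
      using L xy by (simp add: vec.subspace_diff)
    moreover have "a * f (x - y) \<in> K"
      using K_mult that f(2) \<open>x - y \<in> L\<close> by blast
    ultimately show "x = y"
      using T_eq_0 f_eq_0 that by (metis mult_eq_0_iff right_minus_eq)
  qed
  obtain v where v: "v \<in> L" "v \<noteq> 0"
    using d vec.dim_eq_0[of L] by (metis less_irrefl singletonI subsetI)
  have "inj_on g K"
  proof (rule inj_onI)
    fix a b assume ab: "a \<in> K" "b \<in> K" "g a = g b"
    then have "g (a - b) v = g (a - b) 0"
      using g_diff[of a v b] by (simp add: g_def f.zero T.zero)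
    then show "a = b"
      using inj[of "a - b"] K_diff ab v L
      by (metis inj_on_contraD vec.subspace_0 right_minus_eq)
  qed
  show thesis
  proof (rule that[of "g ` (K - {0})"])
    have "card (g ` (K - {0})) = card (K - {0})"
      using \<open>inj_on g K\<close> by (intro card_image) (auto intro: inj_on_subset)
    then show "card (g ` (K - {0})) = CARD('a) ^ vec.dim L - 1"
      using K0 finK cardK by (simp add: m_def)
  next
    fix h x assume "h \<in> g ` (K - {0})" "x \<in> L"
    then show "h x \<in> L"
      using T(1) by (auto simp: g_def)
  next
    fix h1 h2 assume "h1 \<in> g ` (K - {0})" "h2 \<in> g ` (K - {0})" "h1 \<noteq> h2"
    then obtain a b where "a \<in> K" "b \<in> K" "h1 = g a" "h2 = g b" "a \<noteq> b"
      by auto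
    then show "inj_on (\<lambda>x. h1 x - h2 x) L"
      using inj[of "a - b"] K_diff by (simp add: g_diff)
  qed (use linear inj in auto)
qed

section \<open>Families of pairs of subspaces\<close>

abbreviation set_sum :: "('a::field^'n) set \<Rightarrow> ('a^'n) set \<Rightarrow> ('a^'n) set" where
  "set_sum S T \<equiv> {x + y | x y. x \<in> S \<and> y \<in> T}"

text \<open>The two conditions are dual: the second says that the annihilators, within the dual of
  \<open>V\<close>, of the second components meet trivially.\<close>

definition transversal ::
  "('a::field ^ 'n) set \<Rightarrow> ('a ^ 'n) set \<times> ('a ^ 'n) set \<Rightarrow> ('a ^ 'n) set \<times> ('a ^ 'n) set \<Rightarrow> bool"
  where "transversal V P Q \<longleftrightarrow> fst P \<inter> fst Q = {0} \<and> set_sum (snd P) (snd Q) = V"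

text \<open>Inclusion of \<open>fst P\<close> in \<open>snd P\<close> is left out on purpose: if
  \<open>V\<close> has dimension \<open>k + r\<close> with \<open>r < k\<close>, the second
  component is too small to contain the first.\<close>

definition spread_pair ::
  "nat \<Rightarrow> ('a::field ^ 'n) set \<Rightarrow> ('a ^ 'n) set \<times> ('a ^ 'n) set \<Rightarrow> bool"
  where "spread_pair k V P \<longleftrightarrow>
    vec.subspace (fst P) \<and> vec.subspace (snd P) \<and> fst P \<subseteq> V \<and> snd P \<subseteq> V \<and>
    vec.dim (fst P) = k \<and> vec.dim (snd P) = vec.dim V - k"

definition spread_family ::
  "nat \<Rightarrow> ('a::field ^ 'n) set \<Rightarrow> (('a ^ 'n) set \<times> ('a ^ 'n) set) set \<Rightarrow> bool"
  where "spread_family k V S \<longleftrightarrow>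
    (\<forall>P\<in>S. spread_pair k V P) \<and> pairwise (transversal V) S"

lemma set_sum_commute: "set_sum S T = set_sum T S"
  by (auto; metis add.commute)

lemma transversal_commute: "transversal V P Q \<longleftrightarrow> transversal V Q P"
  by (simp add: transversal_def Int_commute set_sum_commute)

text \<open>Later counts rest on this: \<open>fst P\<close> meets itself in dimension
  \<open>k > 0\<close>, so transversality also separates pairs.\<close>

lemma transversal_imp_neq:
  assumes "transversal V P Q" "spread_pair k V P" "k > 0"
  shows "P \<noteq> Q"
  using assms vec.dim_eq_0[of "fst P"] by (auto simp: transversal_def spread_pair_def)

lemma spread_family_Un:
  assumes "spread_family k V S" "spread_family k V T"
    and "\<And>P Q. P \<in> S \<Longrightarrow> Q \<in> T \<Longrightarrow> transversal V P Q"
  shows "spread_family k V (S \<union> T)"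
  using assms unfolding spread_family_def pairwise_def by (metis Un_iff transversal_commute)

lemma spread_family_disjoint:
  assumes "spread_family k V S" "k > 0"
    and "\<And>P Q. P \<in> S \<Longrightarrow> Q \<in> T \<Longrightarrow> transversal V P Q"
  shows "S \<inter> T = {}"
  using assms by (metis disjoint_iff spread_family_def transversal_imp_neq)

text \<open>In the decomposition of \<open>V\<close> into \<open>E\<close> and \<open>L\<close>,
  trivial intersections come from injectivity of \<open>g\<close> and \<open>g - h\<close> on
  \<open>L\<close>, and spanning comes from their surjectivity.\<close>

lemma spread_family_step:
  fixes V :: "('a::{field,finite} ^ 'n) set"
  assumes V: "vec.subspace V" "vec.subspace E" "vec.subspace L"
    and EL: "E \<inter> L = {0}" "set_sum E L = V"
    and dims: "vec.dim E = k" "k \<le> vec.dim L" "k > 0"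
    and S: "spread_family k L S" "finite S" "P0 \<in> S"
    and nested: "\<And>P. P \<in> S - {P0} \<Longrightarrow> fst P \<subseteq> snd P"
  obtains S' where "spread_family k V S'" "finite S'" "card S' = card S + CARD('a) ^ vec.dim L"
    "\<And>P. P \<in> S' \<Longrightarrow> fst P \<subseteq> snd P"
proof -
  have dimV: "vec.dim V = k + vec.dim L"
    using vec.dim_sums_Int[OF V(2,3)] EL dims(1) by simp
  have E_sub: "E \<subseteq> V" and L_sub: "L \<subseteq> V"
    using EL(2) V(2,3) vec.subspace_0 by force+
  have EL_unique: "e = e' \<and> l = l'" if "e + l = e' + l'" "e \<in> E" "e' \<in> E" "l \<in> L" "l' \<in> L" for e e' l l'
  proof -
    have "e - e' = l' - l"
      using that(1) by (simp add: algebra_simps)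
    then have "e - e' \<in> E \<inter> L"
      using that V(2,3) by (metis IntI vec.subspace_diff)
    then show ?thesis
      using EL(1) that(1) by simp
  qed
  have memV: "e + l \<in> V" if "e \<in> E" "l \<in> L" for e l
    using EL(2) that by blast
  have sumV: "set_sum A B = V"
    if "A \<subseteq> V" "B \<subseteq> V" "\<And>e l. e \<in> E \<Longrightarrow> l \<in> L \<Longrightarrow> \<exists>a\<in>A. \<exists>b\<in>B. e + l = a + b" for A B
  proof (intro equalityI subsetI)
    fix x assume "x \<in> set_sum A B"
    then show "x \<in> V"
      using that(1,2) V(1) by (auto intro: vec.subspace_add)
  next
    fix x assume "x \<in> V"
    then obtain e l where "e \<in> E" "l \<in> L" "x = e + l"
      using EL(2) by blast
    then show "x \<in> set_sum A B"
      using that(3)[of e l] by blast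
  qed

  \<comment> \<open>The embedding exists since \<open>k \<le> vec.dim L\<close>. The identity
    \<open>p (s e) = e\<close> is what later puts \<open>U g\<close> inside
    \<open>W g\<close>.\<close>
  obtain s p where s: "vlinear s" "s ` E \<subseteq> L" "inj_on s E"
    and p: "vlinear p" "range p \<subseteq> E" "\<And>e. e \<in> E \<Longrightarrow> p (s e) = e"
  proof -
    obtain M where M: "vec.subspace M" "M \<subseteq> vec.span L" "vec.dim M = k"
      using vec.choose_subspace_of_subspace[OF dims(2)] by blast
    obtain s where s: "vlinear s" "s ` E = M" "inj_on s E"
      using vec.subspace_isomorphism[OF V(2) M(1)] dims(1) M(3) by auto
    show thesis
      using that[of s] s M(2) V(3) vec.linear_exists_left_inverse_on[OF s(1) V(2) s(3)]
        vec.span_eq_iff by metis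
  qed
  interpret s: Vector_Spaces.linear "(*s)" "(*s)" s by fact
  interpret p: Vector_Spaces.linear "(*s)" "(*s)" p by fact
  have s_eq_0: "e = 0" if "e \<in> E" "s e = 0" for e
    using p(3)[OF that(1)] that(2) by (simp add: p.zero)
  have s_mem: "s e \<in> L" if "e \<in> E" for e
    using s(2) that by blast
  have p_mem: "p y \<in> E" for y
    using p(2) by blast
  have "vec.dim L > 0"
    using dims by simp
  then obtain G where cardG: "card G = CARD('a) ^ vec.dim L - 1"
    and lin: "\<And>g. g \<in> G \<Longrightarrow> vlinear g"
    and G_mem: "\<And>g x. g \<in> G \<Longrightarrow> x \<in> L \<Longrightarrow> g x \<in> L"
    and G_inj: "\<And>g. g \<in> G \<Longrightarrow> inj_on g L"
    and G_diff: "\<And>g h. g \<in> G \<Longrightarrow> h \<in> G \<Longrightarrow> g \<noteq> h \<Longrightarrow> inj_on (\<lambda>x. g x - h x) L"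
    by (rule ex_linear_maps_injective_differences[OF V(3)]) (rule that)
  have finL: "finite L"
    by simp
  \<comment> \<open>Injective self-maps of the finite set \<open>L\<close> are onto; the same holds
    for differences.\<close>
  have G_surj: "g ` L = L" if "g \<in> G" for g
    using that by (intro endo_inj_surj finL G_inj) (auto intro: G_mem)
  have G_diff_surj: "(\<lambda>x. g x - h x) ` L = L" if "g \<in> G" "h \<in> G" "g \<noteq> h" for g h
  proof (rule endo_inj_surj[OF finL _ G_diff[OF that]])
    show "(\<lambda>x. g x - h x) ` L \<subseteq> L"
      using that G_mem V(3) by (simp add: image_subset_iff vec.subspace_diff)
  qed
  have G_0: "g 0 = 0" if "g \<in> G" for g
    by (rule vec.linear_0[OF lin[OF that]])

  \<comment> \<open>\<open>U g\<close> is the graph of \<open>g\<close> after \<open>s\<close> over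
    \<open>E\<close>. As \<open>g\<close> is bijective on \<open>L\<close>, \<open>W g\<close> is
    the graph over \<open>L\<close> of \<open>p\<close> after the inverse of
    \<open>g\<close>.\<close>
  define U where "U g = (\<lambda>e. e + g (s e)) ` E" for g
  define W where "W g = (\<lambda>y. p y + g y) ` L" for g
  define SG where "SG = (\<lambda>g. (U g, W g)) ` G"
  define lift where "lift P = (fst P, set_sum E (snd P))" for P :: "('a ^ 'n) set \<times> ('a ^ 'n) set"
  define SL where "SL = lift ` (S - {P0})"
  define S0 where "S0 = {(fst P0, L), (E, set_sum E (snd P0))}"

  have pairS: "spread_pair k L P" if "P \<in> S" for P
    using S(1) that by (simp add: spread_family_def)
  have transS: "transversal L P Q" if "P \<in> S" "Q \<in> S" "P \<noteq> Q" for P Q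
    using S(1) that by (auto simp: spread_family_def pairwise_def)
  have UL: "fst P \<subseteq> L" "snd P \<subseteq> L" "0 \<in> fst P" "0 \<in> snd P" if "P \<in> S" for P
    using pairS[OF that] by (auto simp: spread_pair_def vec.subspace_0)
  have lift_sub: "set_sum E (snd P) \<subseteq> V" if "P \<in> S" for P
    using UL[OF that] memV by blast
  have dim_lift: "vec.dim (set_sum E (snd P)) = vec.dim L" if "P \<in> S" for P
  proof -
    have "E \<inter> snd P = {0}"
      using EL(1) UL[OF that] vec.subspace_0[OF V(2)] by blast
    then show ?thesis
      using vec.dim_sums_Int[OF V(2), of "snd P"] pairS[OF that] dims by (simp add: spread_pair_def)
  qed
  have subspace_lift: "vec.subspace (set_sum E (snd P))" if "P \<in> S" for P
    using V(2) pairS[OF that] by (intro vec.subspace_sums) (simp_all add: spread_pair_def)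
  have memE: "e \<in> set_sum E (snd P)" if "P \<in> S" "e \<in> E" for P e
    using UL(4)[OF that(1)] that(2) by force

  have pairG: "spread_pair k V (U g, W g)" if g: "g \<in> G" for g
  proof -
    interpret g: Vector_Spaces.linear "(*s)" "(*s)" g by (rule lin[OF g])
    have lU: "vlinear (\<lambda>e. e + g (s e))"
      by unfold_locales (simp_all add: s.add s.scale g.add g.scale vec.scale_right_distrib)
    have lW: "vlinear (\<lambda>y. p y + g y)"
      by unfold_locales (simp_all add: p.add p.scale g.add g.scale vec.scale_right_distrib)
    have iU: "inj_on (\<lambda>e. e + g (s e)) E"
      by (rule inj_onI) (metis EL_unique G_mem[OF g] s_mem)
    have iW: "inj_on (\<lambda>y. p y + g y) L"
      by (rule inj_onI) (metis EL_unique G_mem[OF g] p_mem G_inj[OF g] inj_onD)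
    have "vec.dim (U g) = k"
      unfolding U_def using vec.dim_image_eq[OF lU, of E] iU V(2) dims(1)
      by (simp add: vec.span_eq_iff[THEN iffD2])
    moreover have "vec.dim (W g) = vec.dim L"
      unfolding W_def using vec.dim_image_eq[OF lW, of L] iW V(3)
      by (simp add: vec.span_eq_iff[THEN iffD2])
    moreover have "vec.subspace (U g)" "vec.subspace (W g)"
      unfolding U_def W_def using V lU lW by (auto intro: vec.linear_subspace_image)
    moreover have "U g \<subseteq> V" "W g \<subseteq> V"
      using memV G_mem[OF g] s_mem p_mem by (auto simp: U_def W_def)
    ultimately show "spread_pair k V (U g, W g)"
      using dimV by (simp add: spread_pair_def)
  qed
  have transG: "transversal V (U g, W g) (U h, W h)"
    if g: "g \<in> G" and h: "h \<in> G" and "g \<noteq> h" for g h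
  proof -
    interpret h: Vector_Spaces.linear "(*s)" "(*s)" h by (rule lin[OF h])
    have "x = 0" if x: "x \<in> U g" "x \<in> U h" for x
    proof -
      obtain e e' where e: "e \<in> E" "e' \<in> E" "x = e + g (s e)" "x = e' + h (s e')"
        using x by (auto simp: U_def)
      then have "e = e'" "g (s e) = h (s e')"
        using EL_unique G_mem g h s_mem by metis+
      then have "g (s e) - h (s e) = g 0 - h 0"
        using G_0 g h by simp
      then have "s e = 0"
        using G_diff[OF g h \<open>g \<noteq> h\<close>] s_mem e(1) V(3) vec.subspace_0 by (meson inj_onD)
      then show "x = 0"
        using s_eq_0[OF e(1)] e(3) G_0[OF g] by simp
    qed
    moreover have "0 \<in> U f" if "f \<in> G" for f
      unfolding U_def using that G_0 vec.subspace_0[OF V(2)]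
      by (intro image_eqI[of _ _ 0]) (auto simp: s.zero)
    ultimately have "U g \<inter> U h = {0}"
      using g h by auto
    moreover have "set_sum (W g) (W h) = V"
    proof (rule sumV)
      fix e l assume e: "e \<in> E" and l: "l \<in> L"
      \<comment> \<open>Needed are \<open>y\<close> and \<open>y'\<close> in \<open>L\<close> with
        \<open>p y + p y' = e\<close> and \<open>g y + h y' = l\<close>. The choice
        \<open>y' = s e - y\<close> settles the first equation and turns the second into
        \<open>g y - h y = l - h (s e)\<close>.\<close>
      define w where "w = s e"
      have w: "w \<in> L" "p w = e"
        using e s_mem p(3) by (auto simp: w_def)
      have "l - h w \<in> L"
        using l G_mem[OF h w(1)] V(3) by (simp add: vec.subspace_diff)
      then have "l - h w \<in> (\<lambda>x. g x - h x) ` L"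
        using G_diff_surj[OF g h \<open>g \<noteq> h\<close>] by simp
      then obtain y where y: "y \<in> L" "g y - h y = l - h w"
        by auto
      have "w - y \<in> L"
        using w y V(3) by (simp add: vec.subspace_diff)
      moreover have "e + l = (p y + g y) + (p (w - y) + h (w - y))"
        using y(2) w(2) by (simp add: p.diff h.diff algebra_simps)
      ultimately show "\<exists>a\<in>W g. \<exists>b\<in>W h. e + l = a + b"
        unfolding W_def using y(1) by blast
    qed (use memV G_mem g h p_mem in \<open>auto simp: W_def\<close>)
    ultimately show "transversal V (U g, W g) (U h, W h)"
      by (simp add: transversal_def)
  qed
  have familyG: "spread_family k V SG"
    unfolding spread_family_def SG_def pairwise_def using pairG transG by blast

  have trans_lift: "transversal V (lift P) (lift Q)" if PQ: "P \<in> S" "Q \<in> S" "P \<noteq> Q" for P Q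
  proof -
    have "set_sum (set_sum E (snd P)) (set_sum E (snd Q)) = V"
    proof (rule sumV)
      fix e l assume e: "e \<in> E" and l: "l \<in> L"
      then obtain a b where ab: "a \<in> snd P" "b \<in> snd Q" "l = a + b"
        using transS[OF PQ] unfolding transversal_def by blast
      have "e + a \<in> set_sum E (snd P)" "0 + b \<in> set_sum E (snd Q)"
        using e ab vec.subspace_0[OF V(2)] by blast+
      moreover have "e + l = (e + a) + (0 + b)"
        using ab(3) by simp
      ultimately show "\<exists>a\<in>set_sum E (snd P). \<exists>b\<in>set_sum E (snd Q). e + l = a + b"
        by blast
    qed (use lift_sub PQ in auto)
    then show ?thesis
      using transS[OF PQ] by (simp add: transversal_def lift_def)
  qed
  have pair_lift: "spread_pair k V (lift P)" if "P \<in> S" for P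
    using pairS[OF that] UL[OF that] L_sub lift_sub[OF that] dim_lift[OF that] dimV
      subspace_lift[OF that]
    by (auto simp: spread_pair_def lift_def)
  have familyL: "spread_family k V SL"
    unfolding spread_family_def SL_def pairwise_def using pair_lift trans_lift by blast

  have sum_L_lift: "set_sum L (set_sum E (snd P)) = V" if "P \<in> S" for P
  proof (rule sumV)
    fix e l assume "e \<in> E" "l \<in> L"
    then show "\<exists>a\<in>L. \<exists>b\<in>set_sum E (snd P). e + l = a + b"
      using memE[OF that] add.commute[of e l] by blast
  qed (use L_sub lift_sub[OF that] in auto)
  have sum_lift_L: "set_sum (set_sum E (snd P)) L = V" if "P \<in> S" for P
    using sum_L_lift[OF that] by (subst set_sum_commute)
  have E_fst: "E \<inter> fst P = {0}" if "P \<in> S" for P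
    using EL(1) UL[OF that] vec.subspace_0[OF V(2)] by blast
  have trans0: "transversal V (fst P0, L) (E, set_sum E (snd P0))"
    using sum_L_lift[OF S(3)] E_fst[OF S(3)] by (simp add: transversal_def Int_commute)
  have "spread_pair k V (fst P0, L)"
    using pairS[OF S(3)] UL(1)[OF S(3)] L_sub dimV V(3) by (auto simp: spread_pair_def)
  moreover have "spread_pair k V (E, set_sum E (snd P0))"
    using pair_lift[OF S(3)] V(2) E_sub dims(1) by (simp add: spread_pair_def lift_def)
  ultimately have family0: "spread_family k V S0"
    using trans0 trans0[unfolded transversal_commute[of V "(fst P0, L)"]]
    by (simp add: spread_family_def S0_def pairwise_insert)
  \<comment> \<open>Each half of the exchange inherits one condition from \<open>R\<close> and
    \<open>P0\<close>: \<open>(fst P0, L)\<close> the trivial intersection, the other half the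
    spanning.\<close>
  have trans_L0: "transversal V P Q" if PQ: "P \<in> SL" "Q \<in> S0" for P Q
  proof -
    obtain R where R: "R \<in> S" "R \<noteq> P0" "P = lift R"
      using PQ(1) by (auto simp: SL_def)
    have tR: "transversal V (lift R) (lift P0)" "transversal L R P0"
      using trans_lift transS R S(3) by auto
    consider "Q = (fst P0, L)" | "Q = (E, set_sum E (snd P0))"
      using PQ(2) by (auto simp: S0_def)
    then show ?thesis
    proof cases
      case 1
      then show ?thesis
        using tR sum_lift_L[OF R(1)] R(3)
        by (simp add: transversal_def lift_def)
    next
      case 2
      then show ?thesis
        using tR E_fst[OF R(1)] R(3) by (simp add: transversal_def lift_def Int_commute)
    qed
  qed

  have U_L: "U g \<inter> Y = {0}" if "g \<in> G" "Y \<subseteq> L" "0 \<in> Y" for g Y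
  proof -
    have "x = 0" if x: "x \<in> U g" "x \<in> Y" for x
    proof -
      obtain e where e: "e \<in> E" "x = e + g (s e)"
        using x(1) by (auto simp: U_def)
      have "0 + x = e + g (s e)" "x \<in> L"
        using e(2) x(2) \<open>Y \<subseteq> L\<close> by auto
      then have "e = 0"
        using EL_unique[of 0 x e] e(1) G_mem[OF \<open>g \<in> G\<close>] s_mem vec.subspace_0[OF V(2)] by metis
      then show "x = 0"
        using e(2) G_0[OF \<open>g \<in> G\<close>] by (simp add: s.zero)
    qed
    moreover have "0 \<in> U g"
      unfolding U_def using that G_0 vec.subspace_0[OF V(2)]
      by (intro image_eqI[of _ _ 0]) (auto simp: s.zero)
    ultimately show ?thesis
      using that by auto
  qed
  have U_E: "U g \<inter> E = {0}" if "g \<in> G" for g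
  proof -
    have "x = 0" if x: "x \<in> U g" "x \<in> E" for x
    proof -
      obtain e where e: "e \<in> E" "x = e + g (s e)"
        using x(1) by (auto simp: U_def)
      then have "g (s e) = 0"
        using EL_unique[of x 0 e] x(2) G_mem[OF \<open>g \<in> G\<close>] s_mem vec.subspace_0[OF V(3)]
        by (metis add.right_neutral)
      then have "s e = 0"
        using G_inj[OF \<open>g \<in> G\<close>] G_0[OF \<open>g \<in> G\<close>] s_mem[OF e(1)] vec.subspace_0[OF V(3)]
        by (metis inj_onD)
      then show "x = 0"
        using e \<open>g (s e) = 0\<close> s_eq_0 by simp
    qed
    moreover have "0 \<in> U g"
      unfolding U_def using that G_0 vec.subspace_0[OF V(2)]
      by (intro image_eqI[of _ _ 0]) (auto simp: s.zero)
    ultimately show ?thesis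
      using vec.subspace_0[OF V(2)] by auto
  qed
  have W_sub: "W g \<subseteq> V" if "g \<in> G" for g
    using that memV G_mem p_mem by (auto simp: W_def)
  have W_L: "set_sum (W g) L = V" if "g \<in> G" for g
  proof (rule sumV)
    fix e l assume e: "e \<in> E" and l: "l \<in> L"
    have "e + g (s e) \<in> W g"
      unfolding W_def
      by (rule image_eqI[of _ _ "s e"]) (simp_all add: p(3)[OF e] s_mem[OF e])
    moreover have "l - g (s e) \<in> L"
      using l G_mem[OF that s_mem[OF e]] V(3) by (simp add: vec.subspace_diff)
    moreover have "e + l = (e + g (s e)) + (l - g (s e))"
      by simp
    ultimately show "\<exists>a\<in>W g. \<exists>b\<in>L. e + l = a + b"
      by blast
  qed (use W_sub[OF that] L_sub in auto)
  have W_lift: "set_sum (W g) (set_sum E (snd P)) = V" if "g \<in> G" "P \<in> S" for g P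
  proof (rule sumV)
    fix e l assume e: "e \<in> E" and l: "l \<in> L"
    \<comment> \<open>\<open>W g\<close> and \<open>E\<close> already span \<open>V\<close>: solving
      \<open>g y = l\<close> fixes the component in \<open>L\<close>, and \<open>E\<close> corrects
      the rest.\<close>
    have "l \<in> g ` L"
      using G_surj[OF that(1)] l by simp
    then obtain y where y: "y \<in> L" "g y = l"
      by auto
    have "p y + l \<in> W g"
      unfolding W_def using y by blast
    moreover have "e - p y \<in> set_sum E (snd P)"
      using e p_mem V(2) by (intro memE that) (simp add: vec.subspace_diff)
    moreover have "e + l = (p y + l) + (e - p y)"
      by simp
    ultimately show "\<exists>a\<in>W g. \<exists>b\<in>set_sum E (snd P). e + l = a + b"
      by blast
  qed (use W_sub lift_sub that in auto)
  have trans_G: "transversal V P Q" if PQ: "P \<in> SG" "Q \<in> SL \<union> S0" for P Q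
  proof -
    obtain g where g: "g \<in> G" "P = (U g, W g)"
      using PQ(1) by (auto simp: SG_def)
    consider R where "R \<in> S" "Q = lift R" | "Q = (fst P0, L)" | "Q = (E, set_sum E (snd P0))"
      using PQ(2) by (auto simp: SL_def S0_def)
    then show ?thesis
    proof cases
      case 1
      then show ?thesis
        using g U_L[OF g(1)] W_lift[OF g(1)] UL by (simp add: transversal_def lift_def)
    next
      case 2
      then show ?thesis
        using g U_L[OF g(1)] W_L[OF g(1)] UL[OF S(3)] by (simp add: transversal_def)
    next
      case 3
      then show ?thesis
        using g U_E[OF g(1)] W_lift[OF g(1)] S(3) by (simp add: transversal_def)
    qed
  qed

  have family_L0: "spread_family k V (SL \<union> S0)"
    by (rule spread_family_Un[OF familyL family0 trans_L0])
  have finG: "finite G"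
    by simp
  have "inj_on (\<lambda>g. (U g, W g)) G"
  proof (rule inj_onI, rule ccontr)
    fix g h assume gh: "g \<in> G" "h \<in> G" "(U g, W g) = (U h, W h)" "g \<noteq> h"
    show False
      using transversal_imp_neq[OF transG[OF gh(1,2,4)] pairG[OF gh(1)] dims(3)] gh(3) by simp
  qed
  then have card_SG: "card SG = CARD('a) ^ vec.dim L - 1"
    by (simp add: SG_def card_image cardG)
  have "inj_on lift S"
  proof (rule inj_onI, rule ccontr)
    fix P Q assume PQ: "P \<in> S" "Q \<in> S" "lift P = lift Q" "P \<noteq> Q"
    show False
      using transversal_imp_neq[OF trans_lift[OF PQ(1,2,4)] pair_lift[OF PQ(1)] dims(3)] PQ(3)
      by simp
  qed
  then have card_SL: "card SL = card S - 1"
    using S(2,3) by (simp add: SL_def card_image inj_on_diff)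
  have "(fst P0, L) \<noteq> (E, set_sum E (snd P0))"
    using transversal_imp_neq[OF trans0 _ dims(3)] family0 by (simp add: spread_family_def S0_def)
  then have card_S0: "card S0 = 2"
    by (simp add: S0_def)
  have fin: "finite SG" "finite SL" "finite S0"
    using finG S(2) by (simp_all add: SG_def SL_def S0_def)
  have "card (SG \<union> (SL \<union> S0)) = card SG + (card SL + card S0)"
  proof -
    have "SG \<inter> (SL \<union> S0) = {}"
      by (rule spread_family_disjoint[OF familyG dims(3)]) (rule trans_G)
    moreover have "SL \<inter> S0 = {}"
      by (rule spread_family_disjoint[OF familyL dims(3)]) (rule trans_L0)
    ultimately show ?thesis
      using fin by (simp add: card_Un_disjoint)
  qed
  \<comment> \<open>Positivity makes the truncated subtractions exact in the total
    \<open>(CARD('a) ^ vec.dim L - 1) + (card S - 1) + 2\<close>.\<close>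
  moreover have "card S > 0"
    using S(2,3) card_gt_0_iff by blast
  moreover have "CARD('a) ^ vec.dim L > 0"
    by simp
  ultimately have "card (SG \<union> (SL \<union> S0)) = card S + CARD('a) ^ vec.dim L"
    using card_SG card_SL card_S0 by linarith
  moreover have "fst P \<subseteq> snd P" if P: "P \<in> SG \<union> (SL \<union> S0)" for P
  proof -
    consider g where "g \<in> G" "P = (U g, W g)" | R where "R \<in> S - {P0}" "P = lift R"
      | "P = (fst P0, L)" | "P = (E, set_sum E (snd P0))"
      using P unfolding SG_def SL_def S0_def by blast
    then show ?thesis
    proof cases
      case 1
      have "e + g (s e) \<in> W g" if "e \<in> E" for e
        unfolding W_def
        by (rule image_eqI[of _ _ "s e"]) (simp_all add: p(3)[OF that] s_mem[OF that])
      then show ?thesis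
        using 1 by (auto simp: U_def)
    next
      case 2
      then have "fst R \<subseteq> snd R"
        by (rule_tac nested)
      then show ?thesis
        using 2 vec.subspace_0[OF V(2)] by (force simp: lift_def)
    next
      case 3
      then show ?thesis
        using UL[OF S(3)] by simp
    next
      case 4
      then show ?thesis
        using memE[OF S(3)] by auto
    qed
  qed
  ultimately show thesis
    using that[OF spread_family_Un[OF familyG family_L0 trans_G]] fin by blast
qed

section \<open>Induction on the dimension, in steps of \<open>k\<close>\<close>

lemma ex_complement_subspace:
  fixes V :: "('a::field ^ 'n) set"
  assumes V: "vec.subspace V" and E: "vec.subspace E" "E \<subseteq> V"
  obtains L where "vec.subspace L" "L \<subseteq> V" "E \<inter> L = {0}" "set_sum E L = V"
proof -
  obtain p where p: "range p \<subseteq> E" "vlinear p" "\<And>e. e \<in> E \<Longrightarrow> p e = e"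
    using vec.linear_exists_left_inverse_on[OF vec.linear_ident E(1)] by auto
  interpret p: Vector_Spaces.linear "(*s)" "(*s)" p by fact
  define L where "L = {x \<in> V. p x = 0}"
  have p_mem: "p x \<in> E" for x
    using p(1) by blast
  show thesis
  proof (rule that[of L])
    show "vec.subspace L"
      using V by (auto simp: L_def vec.subspace_def p.zero p.add p.scale)
    show "E \<inter> L = {0}"
      using p(3) V E by (auto simp: L_def p.zero vec.subspace_0)
    show "set_sum E L = V"
    proof (intro equalityI subsetI)
      fix x assume "x \<in> set_sum E L"
      then show "x \<in> V"
        using V E(2) by (auto simp: L_def intro: vec.subspace_add)
    next
      fix x assume "x \<in> V"
      then have "x - p x \<in> L"
        using V E(2) p_mem by (auto simp: L_def p.diff p(3) intro: vec.subspace_diff)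
      moreover have "x = p x + (x - p x)"
        by simp
      ultimately show "x \<in> set_sum E L"
        using p_mem by blast
    qed
  qed (auto simp: L_def)
qed

text \<open>The exceptional \<open>P0\<close> serves the base case, a single pair whose second
  component has dimension \<open>r\<close>, possibly below \<open>k\<close>. Each step makes all
  pairs nested, and then any of them can be marked for the next exchange.\<close>

lemma ex_almost_nested_spread_family:
  fixes V :: "('a::{field,finite} ^ 'n) set"
  assumes "vec.subspace V" "vec.dim V = k + r + m * k" "k > 0"
  shows "\<exists>S P0. spread_family k V S \<and> finite S \<and> P0 \<in> S \<and> (\<forall>P\<in>S - {P0}. fst P \<subseteq> snd P) \<and>
    card S = 1 + (\<Sum>i<m. CARD('a) ^ (k + r + i * k)) \<and> (m > 0 \<longrightarrow> (\<forall>P\<in>S. fst P \<subseteq> snd P))"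
  using assms
proof (induction m arbitrary: V)
  case 0
  have "k \<le> vec.dim V"
    using 0 by simp
  then obtain U where U: "vec.subspace U" "U \<subseteq> vec.span V" "vec.dim U = k"
    by (rule vec.choose_subspace_of_subspace)
  have "r \<le> vec.dim V"
    using 0 by simp
  then obtain W where W: "vec.subspace W" "W \<subseteq> vec.span V" "vec.dim W = r"
    by (rule vec.choose_subspace_of_subspace)
  have "vec.span V = V"
    using 0 by (simp add: vec.span_eq_iff)
  then have "U \<subseteq> V" "W \<subseteq> V"
    using U(2) W(2) by metis+
  then have "spread_family k V {(U, W)}"
    using U W 0(2) by (simp add: spread_family_def spread_pair_def)
  then show ?case
    by (intro exI[of _ "{(U, W)}"] exI[of _ "(U, W)"]) simp
next
  case (Suc m)
  have "k \<le> vec.dim V"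
    using Suc.prems by simp
  then obtain E where E: "vec.subspace E" "E \<subseteq> vec.span V" "vec.dim E = k"
    by (rule vec.choose_subspace_of_subspace)
  have "vec.span V = V"
    using Suc.prems by (simp add: vec.span_eq_iff)
  then have "E \<subseteq> V"
    using E(2) by metis
  then obtain L where L: "vec.subspace L" "L \<subseteq> V" "E \<inter> L = {0}" "set_sum E L = V"
    by (rule ex_complement_subspace[OF Suc.prems(1) E(1)]) (rule that)
  have dimL: "vec.dim L = k + r + m * k"
    using vec.dim_sums_Int[OF E(1) L(1)] L(3,4) E(3) Suc.prems(2) by simp
  obtain S P0 where S: "spread_family k L S" "finite S" "P0 \<in> S" "\<forall>P\<in>S - {P0}. fst P \<subseteq> snd P"
    and cardS: "card S = 1 + (\<Sum>i<m. CARD('a) ^ (k + r + i * k))"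
    using Suc.IH[OF L(1) dimL Suc.prems(3)] by (elim exE conjE) (rule that)
  have kL: "k \<le> vec.dim L"
    using dimL by simp
  have nested: "fst P \<subseteq> snd P" if "P \<in> S - {P0}" for P
    using S(4) that by blast
  obtain S' where S': "spread_family k V S'" "finite S'"
      "card S' = card S + CARD('a) ^ vec.dim L" "\<And>P. P \<in> S' \<Longrightarrow> fst P \<subseteq> snd P"
    by (rule spread_family_step[OF Suc.prems(1) E(1) L(1,3,4) E(3) kL Suc.prems(3) S(1-3) nested], assumption)
      (rule that)
  have "card S' > 0"
    using S'(3) cardS by simp
  then obtain P1 where "P1 \<in> S'"
    using S'(2) by (metis card_gt_0_iff ex_in_conv)
  then show ?case
    using S' cardS dimL by (intro exI[of _ S'] exI[of _ P1]) simp
qed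

section \<open>Flags through the pairs\<close>

text \<open>One vector is added at a time. Indexing the chain by dimension lets a flag of any type
  be read off from it.\<close>

lemma ex_subspace_chain:
  fixes S T :: "('a::field ^ 'n) set"
  assumes "vec.subspace S" "vec.subspace T" "S \<subseteq> T"
  shows "\<exists>H. (\<forall>t\<in>{vec.dim S..vec.dim T}. vec.subspace (H t) \<and> vec.dim (H t) = t \<and> S \<subseteq> H t \<and> H t \<subseteq> T)
    \<and> (\<forall>u\<in>{vec.dim S..vec.dim T}. \<forall>t\<in>{vec.dim S..u}. H t \<subseteq> H u)"
  using assms
proof (induction "vec.dim T - vec.dim S" arbitrary: S)
  case 0
  then have "S = T"
    by (intro vec.subspace_dim_equal) auto
  then show ?case
    using 0 by (intro exI[of _ "\<lambda>_. S"]) auto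
next
  case (Suc e)
  then have "S \<noteq> T" by auto
  then obtain x where x: "x \<in> T" "x \<notin> S"
    using Suc.prems by blast
  define S' where "S' = vec.span (insert x S)"
  have dim: "vec.dim S' = Suc (vec.dim S)"
    using x Suc.prems by (simp add: S'_def vec.dim_insert vec.span_eq_iff[THEN iffD2])
  have "S' \<subseteq> T"
    unfolding S'_def using x Suc.prems by (intro vec.span_minimal) auto
  have "S \<subseteq> S'"
    unfolding S'_def using vec.span_superset by blast
  have "e = vec.dim T - vec.dim S'"
    using Suc.hyps dim by simp
  then obtain H where H:
    "\<forall>t\<in>{vec.dim S'..vec.dim T}. vec.subspace (H t) \<and> vec.dim (H t) = t \<and> S' \<subseteq> H t \<and> H t \<subseteq> T"
    "\<forall>u\<in>{vec.dim S'..vec.dim T}. \<forall>t\<in>{vec.dim S'..u}. H t \<subseteq> H u"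
    using Suc.hyps(1)[of S'] Suc.prems(2) \<open>S' \<subseteq> T\<close> by (auto simp: S'_def)
  show ?case
  proof (intro exI[of _ "\<lambda>t. if t \<le> vec.dim S then S else H t"] conjI ballI)
    fix t assume "t \<in> {vec.dim S..vec.dim T}"
    moreover have "S \<subseteq> H t" if "t \<in> {vec.dim S'..vec.dim T}"
      using H(1) that \<open>S \<subseteq> S'\<close> by blast
    ultimately show "vec.subspace (if t \<le> vec.dim S then S else H t)"
      "vec.dim (if t \<le> vec.dim S then S else H t) = t"
      "S \<subseteq> (if t \<le> vec.dim S then S else H t)" "(if t \<le> vec.dim S then S else H t) \<subseteq> T"
      using H(1) dim Suc.prems by (auto simp: not_le Suc_le_eq)
  next
    fix u t assume "u \<in> {vec.dim S..vec.dim T}" "t \<in> {vec.dim S..u}"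
    moreover have "S \<subseteq> H u" if "u \<in> {vec.dim S'..vec.dim T}"
      using H(1) that \<open>S \<subseteq> S'\<close> by blast
    ultimately show "(if t \<le> vec.dim S then S else H t) \<subseteq> (if u \<le> vec.dim S then S else H u)"
      using H(2) dim by (auto simp: not_le Suc_le_eq)
  qed
qed

text \<open>A chain from \<open>{0}\<close> to \<open>fst P\<close> is followed by one from
  \<open>snd P\<close> to the whole space; nestedness of the pair joins them. For
  \<open>n = 2 * k\<close> the shared index \<open>k\<close> is assigned to the lower chain.\<close>

lemma ex_flag_through_pair:
  fixes P :: "('a::field ^ 'n) set \<times> ('a ^ 'n) set"
  assumes P: "spread_pair k UNIV P" "fst P \<subseteq> snd P" and n: "n = CARD('n)" "2 * k \<le> n"
  shows "\<exists>H. (\<forall>t\<in>{1..k} \<union> {n - k..n - 1}. vec.subspace (H t) \<and> vec.dim (H t) = t \<and>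
      (if t \<le> k then H t \<subseteq> fst P else snd P \<subseteq> H t)) \<and>
    (\<forall>u\<in>{1..k} \<union> {n - k..n - 1}. \<forall>t\<in>{1..k} \<union> {n - k..n - 1}. t \<le> u \<longrightarrow> H t \<subseteq> H u)"
proof -
  have dimV: "vec.dim (UNIV :: ('a ^ 'n) set) = n"
    using vec.dim_UNIV n by (simp add: card_cart_basis)
  have sub: "vec.subspace (fst P)" "vec.subspace (snd P)"
    and dims: "vec.dim (fst P) = k" "vec.dim (snd P) = n - k"
    using P dimV by (auto simp: spread_pair_def)
  have dim0: "vec.dim {0 :: 'a ^ 'n} = 0"
    by simp
  obtain H1 where H1: "\<forall>t\<in>{0..k}. vec.subspace (H1 t) \<and> vec.dim (H1 t) = t \<and> H1 t \<subseteq> fst P"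
      "\<forall>u\<in>{0..k}. \<forall>t\<in>{0..u}. H1 t \<subseteq> H1 u"
    using ex_subspace_chain[of "{0}" "fst P"] sub dims dim0 vec.subspace_0[OF sub(1)]
    by auto
  obtain H2 where H2:
      "\<forall>t\<in>{n - k..n}. vec.subspace (H2 t) \<and> vec.dim (H2 t) = t \<and> snd P \<subseteq> H2 t"
      "\<forall>u\<in>{n - k..n}. \<forall>t\<in>{n - k..u}. H2 t \<subseteq> H2 u"
    using ex_subspace_chain[of "snd P" UNIV] sub dims dimV by auto
  show ?thesis
  proof (intro exI[of _ "\<lambda>t. if t \<le> k then H1 t else H2 t"] conjI ballI impI)
    fix t assume "t \<in> {1..k} \<union> {n - k..n - 1}"
    then consider "t \<in> {0..k}" | "\<not> t \<le> k" "t \<in> {n - k..n}"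
      by fastforce
    then show "vec.subspace (if t \<le> k then H1 t else H2 t)"
      "vec.dim (if t \<le> k then H1 t else H2 t) = t"
      "if t \<le> k then (if t \<le> k then H1 t else H2 t) \<subseteq> fst P
       else snd P \<subseteq> (if t \<le> k then H1 t else H2 t)"
      using H1(1) H2(1) by (cases; simp)+
  next
    fix u t assume tu: "u \<in> {1..k} \<union> {n - k..n - 1}" "t \<in> {1..k} \<union> {n - k..n - 1}" "t \<le> u"
    then consider "t \<in> {0..u}" "u \<in> {0..k}" | "t \<in> {0..k}" "\<not> u \<le> k" "u \<in> {n - k..n}"
      | "\<not> t \<le> k" "\<not> u \<le> k" "t \<in> {n - k..u}" "u \<in> {n - k..n}"
      by fastforce
    then show "(if t \<le> k then H1 t else H2 t) \<subseteq> (if u \<le> k then H1 u else H2 u)"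
    proof cases
      case 2
      then have "H1 t \<subseteq> fst P" "snd P \<subseteq> H2 u"
        using H1(1) H2(1) by blast+
      then show ?thesis
        using 2 P(2) by auto
    qed (use H1(2) H2(2) in auto)
  qed
qed

text \<open>For \<open>t \<le> k\<close> the two spaces meet trivially, which gives
  \<open>2 * t\<close>. Otherwise they span the whole space, so they meet in dimension
  \<open>2 * t - n\<close>, which gives \<open>2 * (n - t)\<close>.\<close>

lemma subspace_dist_transversal:
  fixes P Q :: "('a::field ^ 'n) set \<times> ('a ^ 'n) set"
  assumes PQ: "transversal UNIV P Q" and n: "n = CARD('n)" "2 * k \<le> n"
    and t: "t \<in> {1..k} \<union> {n - k..n - 1}"
    and F: "vec.subspace F" "vec.dim F = t" "if t \<le> k then F \<subseteq> fst P else snd P \<subseteq> F"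
    and F': "vec.subspace F'" "vec.dim F' = t" "if t \<le> k then F' \<subseteq> fst Q else snd Q \<subseteq> F'"
  shows "subspace_dist F F' = 2 * (if t \<le> n div 2 then t else n - t)"
proof (cases "t \<le> k")
  case True
  then have "F \<inter> F' \<subseteq> {0}"
    using F F' PQ by (auto simp: transversal_def)
  then have dim: "vec.dim (F \<inter> F') = 0"
    by simp
  have "subspace_dist F F' = t + t"
    unfolding subspace_dist_def dim using F F' by simp
  then show ?thesis
    using True n by simp
next
  case False
  then have "set_sum (snd P) (snd Q) \<subseteq> set_sum F F'"
    using F F' by auto
  then have "set_sum F F' = UNIV"
    using PQ by (auto simp: transversal_def)
  then have "n + vec.dim (F \<inter> F') = t + t"
    using vec.dim_sums_Int[OF F(1) F'(1)] F F' n by (simp add: vec.dim_UNIV card_cart_basis)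
  \<comment> \<open>Here \<open>t \<ge> n - k\<close>, which exceeds \<open>n / 2\<close> unless
    \<open>n = 2 * k\<close>; in that case \<open>t > k\<close> decides.\<close>
  moreover have "\<not> t \<le> n div 2"
    using False t n by auto
  ultimately show ?thesis
    using F F' by (simp add: subspace_dist_def)
qed

section \<open>From nested families to optimum distance codes\<close>

lemma max_flag_dist_eq_sum:
  assumes "finite A"
  shows "max_flag_dist n (sorted_list_of_set A) = (\<Sum>t\<in>A. 2 * (if t \<le> n div 2 then t else n - t))"
proof -
  have "{t. t \<in> A \<and> t \<le> n div 2} = A \<inter> {t. t \<le> n div 2}"
    "{t. t \<in> A \<and> t > n div 2} = A \<inter> - {t. t \<le> n div 2}"
    by auto
  then show ?thesis
    using assms
    by (simp add: max_flag_dist_def sum.If_cases add_mult_distrib2 flip: sum_distrib_left)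
qed

text \<open>\<open>Max\<close> bounds its elements only on a finite set; finiteness holds because
  lists of fixed length over a finite type are finite in number.\<close>

lemma card_ODFC_le_max_ODFC_size:
  fixes C :: "('a::{field,finite} ^ 'n) set list set"
  assumes "is_ODFC (sorted_list_of_set A) C"
  shows "card C \<le> max_ODFC_size TYPE('a) TYPE('n) A"
proof -
  define flags where "flags = {F :: ('a ^ 'n) set list. set F \<subseteq> UNIV \<and> length F = length (sorted_list_of_set A)}"
  have fin: "finite flags"
    unfolding flags_def by (rule finite_lists_length_eq) simp
  have "D \<subseteq> flags" if "is_ODFC (sorted_list_of_set A) D" for D :: "('a ^ 'n) set list set"
    using that by (auto simp: flags_def is_ODFC_def is_flag_code_def is_flag_def)
  then have "{card D | D :: ('a ^ 'n) set list set. is_ODFC (sorted_list_of_set A) D} \<subseteq> {..card flags}"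
    using card_mono[OF fin] by auto
  then have "finite {card D | D :: ('a ^ 'n) set list set. is_ODFC (sorted_list_of_set A) D}"
    using finite_subset by blast
  then show ?thesis
    unfolding max_ODFC_size_def using assms by (intro Max_ge) auto
qed

text \<open>Choosing one flag per pair makes all distances between different flags maximal. Two
  pairs are required because \<open>min_flag_dist\<close> is 0 for a single flag.\<close>

lemma card_nested_spread_family_le_max_ODFC_size:
  fixes S :: "(('a::{field,finite} ^ 'n) set \<times> ('a ^ 'n) set) set"
  assumes n: "n = CARD('n)" "2 * k \<le> n" and "k > 0"
    and A: "A \<subseteq> {1..k} \<union> {n - k..n - 1}" "A \<noteq> {}"
    and S: "spread_family k UNIV S" "finite S" "card S \<ge> 2" "\<And>P. P \<in> S \<Longrightarrow> fst P \<subseteq> snd P"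
  shows "card S \<le> max_ODFC_size TYPE('a) TYPE('n) A"
proof -
  define ts where "ts = sorted_list_of_set A"
  have finA: "finite A"
    using A(1) finite_subset by blast
  then have ts: "set ts = A" "distinct ts" "sorted_wrt (<) ts"
    by (simp_all add: ts_def)
  have ts_nth: "ts ! i \<in> A" if "i < length ts" for i
    using that ts(1) nth_mem by blast
  define wt where "wt t = 2 * (if t \<le> n div 2 then t else n - t)" for t
  have A_bounds: "0 < t \<and> t < n" if "t \<in> A" for t
    using that A(1) n \<open>k > 0\<close> by fastforce
  define good where "good P h \<longleftrightarrow> (\<forall>t\<in>A. vec.subspace (h t) \<and> vec.dim (h t) = t \<and>
      (if t \<le> k then h t \<subseteq> fst P else snd P \<subseteq> h t)) \<and> (\<forall>u\<in>A. \<forall>t\<in>A. t \<le> u \<longrightarrow> h t \<subseteq> h u)"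
    for P :: "('a ^ 'n) set \<times> ('a ^ 'n) set" and h
  have "\<exists>h. good P h" if "P \<in> S" for P
  proof -
    have "spread_pair k UNIV P" "fst P \<subseteq> snd P"
      using S that by (auto simp: spread_family_def)
    then obtain h where "\<forall>t\<in>{1..k} \<union> {n - k..n - 1}. vec.subspace (h t) \<and> vec.dim (h t) = t \<and>
        (if t \<le> k then h t \<subseteq> fst P else snd P \<subseteq> h t)"
      "\<forall>u\<in>{1..k} \<union> {n - k..n - 1}. \<forall>t\<in>{1..k} \<union> {n - k..n - 1}. t \<le> u \<longrightarrow> h t \<subseteq> h u"
      using ex_flag_through_pair[OF _ _ n, of P] by (elim meta_impE exE conjE)
    then have "good P h"
      unfolding good_def using A(1) by (meson subsetD)
    then show ?thesis
      by blast
  qed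
  then obtain H where good: "\<And>P. P \<in> S \<Longrightarrow> good P (H P)"
    by metis
  have H: "vec.subspace (H P t) \<and> vec.dim (H P t) = t \<and>
      (if t \<le> k then H P t \<subseteq> fst P else snd P \<subseteq> H P t)" if "P \<in> S" "t \<in> A" for P t
    using good[OF that(1)] that(2) unfolding good_def by blast
  have H_mono: "H P t \<subseteq> H P u" if "P \<in> S" "u \<in> A" "t \<in> A" "t \<le> u" for P t u
    using good[OF that(1)] that(2-4) unfolding good_def by blast
  define F where "F P = map (H P) ts" for P
  have dist_t: "subspace_dist (H P t) (H Q t) = wt t"
    if "P \<in> S" "Q \<in> S" "P \<noteq> Q" "t \<in> A" for P Q t
  proof -
    have "transversal UNIV P Q"
      using S(1) that by (auto simp: spread_family_def pairwise_def)
    moreover have "t \<in> {1..k} \<union> {n - k..n - 1}"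
      using A(1) that(4) by blast
    ultimately show ?thesis
      unfolding wt_def using H[OF that(1,4)] H[OF that(2,4)] n
      by (intro subspace_dist_transversal[of P Q]) blast+
  qed
  have max: "max_flag_dist CARD('n) ts = (\<Sum>t\<in>A. wt t)"
    unfolding ts_def wt_def n(1)[symmetric] by (rule max_flag_dist_eq_sum[OF finA])
  have dist: "flag_dist (F P) (F Q) = max_flag_dist CARD('n) ts" if "P \<in> S" "Q \<in> S" "P \<noteq> Q" for P Q
  proof -
    have "flag_dist (F P) (F Q) = (\<Sum>i<length ts. wt (ts ! i))"
      unfolding flag_dist_def F_def using dist_t[OF that] ts_nth by simp
    also have "\<dots> = sum_list (map wt ts)"
      by (simp add: sum_list_sum_nth atLeast0LessThan)
    also have "\<dots> = (\<Sum>t\<in>A. wt t)"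
      using ts by (simp add: sum_list_distinct_conv_sum_set)
    finally show ?thesis
      using max by simp
  qed
  \<comment> \<open>One position suffices for injectivity: \<open>0 < a < n\<close> makes
    \<open>wt a\<close> positive, whereas equal subspaces have distance 0.\<close>
  obtain a where a: "a \<in> A"
    using A(2) by blast
  have inj: "inj_on F S"
  proof (rule inj_onI, rule ccontr)
    fix P Q assume PQ: "P \<in> S" "Q \<in> S" "F P = F Q" "P \<noteq> Q"
    then have "H P a = H Q a"
      using a ts(1) by (auto simp: F_def)
    then have "wt a = 0"
      using dist_t[OF PQ(1,2,4) a] by (simp add: subspace_dist_def)
    then show False
      using A_bounds[OF a] by (simp add: wt_def split: if_splits)
  qed
  have flag: "is_flag ts (F P)" if "P \<in> S" for P
  proof -
    have "H P (ts ! i) \<subset> H P (ts ! Suc i)" if i: "Suc i < length ts" for i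
    proof -
      have "ts ! i < ts ! Suc i"
        using ts(3) i by (simp add: sorted_wrt_nth_less)
      then show ?thesis
        using H_mono[OF \<open>P \<in> S\<close>, of "ts ! Suc i" "ts ! i"] H[OF \<open>P \<in> S\<close>] ts_nth i
        by (metis Suc_lessD less_imp_le less_irrefl psubsetI)
    qed
    then show ?thesis
      using H[OF that] ts_nth by (simp add: is_flag_def F_def)
  qed
  obtain P Q where PQ: "P \<in> S" "Q \<in> S" "P \<noteq> Q"
    using S(3) by (metis card_le_Suc0_iff_eq S(2) not_less_eq_eq numeral_2_eq_2)
  have "F P \<noteq> F Q"
    using PQ inj by (metis inj_onD)
  have "{flag_dist f1 f2 | f1 f2. f1 \<in> F ` S \<and> f2 \<in> F ` S \<and> f1 \<noteq> f2} = {max_flag_dist CARD('n) ts}"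
  proof (intro equalityI subsetI)
    fix d assume "d \<in> {flag_dist f1 f2 | f1 f2. f1 \<in> F ` S \<and> f2 \<in> F ` S \<and> f1 \<noteq> f2}"
    then show "d \<in> {max_flag_dist CARD('n) ts}"
      using dist by auto
  next
    fix d assume "d \<in> {max_flag_dist CARD('n) ts}"
    then have "d = flag_dist (F P) (F Q)"
      using dist[OF PQ] by simp
    then show "d \<in> {flag_dist f1 f2 | f1 f2. f1 \<in> F ` S \<and> f2 \<in> F ` S \<and> f1 \<noteq> f2}"
      using PQ \<open>F P \<noteq> F Q\<close> by blast
  qed
  moreover have "\<exists>f1\<in>F ` S. \<exists>f2\<in>F ` S. f1 \<noteq> f2"
    using PQ \<open>F P \<noteq> F Q\<close> by blast
  ultimately have "min_flag_dist (F ` S) = max_flag_dist CARD('n) ts"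
    by (simp add: min_flag_dist_def)
  moreover have "is_flag_code ts (F ` S)"
    using ts A_bounds n flag PQ by (auto simp: is_flag_code_def flag_type_def)
  ultimately have "is_ODFC (sorted_list_of_set A) (F ` S)"
    by (simp add: is_ODFC_def ts_def)
  then have "card (F ` S) \<le> max_ODFC_size TYPE('a) TYPE('n) A"
    by (rule card_ODFC_le_max_ODFC_size)
  then show ?thesis
    using inj by (simp add: card_image)
qed

text \<open>The sum telescopes. A ring version avoids truncated subtraction and is applied to
  \<open>real q\<close>.\<close>

lemma geometric_sum_steps:
  fixes x :: "'b::comm_ring_1"
  shows "(x ^ k - 1) * (\<Sum>i<m. x ^ (k + r + i * k)) = x ^ (k + r + m * k) - x ^ (k + r)"
  by (induction m) (simp_all add: distrib_left power_add algebra_simps)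

theorem theorem3p1:
  fixes q n k r :: nat and A :: "nat set"
  assumes "q = CARD('a::{field,finite})" and "n = CARD('n::finite)"
    and "k > 0" and "n \<ge> 2 * k"
    and "A \<subseteq> {1..k} \<union> {n - k..n - 1}"
    and "A \<inter> {k, n - k} \<noteq> {}"
    and "[r = n] (mod k)" and "r < k"
  shows "real (max_ODFC_size TYPE('a) TYPE('n) A)
           \<ge> (real q ^ n - real q ^ (k + r)) / (real q ^ k - 1) + 1"
proof -
  have q: "q \<ge> 2"
    using assms(1) card_field_ge_2[where 'a = 'a] by simp
  have "r = n mod k"
    using assms(7,8) by (simp add: cong_def)
  \<comment> \<open>This makes \<open>m = n div k - 1\<close> positive: at least one induction step
    takes place, so every pair is nested.\<close>
  moreover have "n div k \<ge> 2"
    using assms(3,4) by (simp add: less_eq_div_iff_mult_less_eq)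
  then obtain m where "n div k = Suc m" "m > 0"
    by (cases "n div k") auto
  ultimately have n: "n = k + r + m * k"
    by (metis add.commute add.left_commute mult_Suc div_mult_mod_eq)
  have "vec.dim (UNIV :: ('a ^ 'n) set) = k + r + m * k"
    using assms(2) n by (simp add: vec.dim_UNIV card_cart_basis)
  then obtain S :: "(('a ^ 'n) set \<times> ('a ^ 'n) set) set" where
    S: "spread_family k UNIV S" "finite S" "\<And>P. P \<in> S \<Longrightarrow> fst P \<subseteq> snd P"
    and cardS: "card S = 1 + (\<Sum>i<m. q ^ (k + r + i * k))"
    using ex_almost_nested_spread_family[of "UNIV :: ('a ^ 'n) set" k r m] assms(1,3) \<open>m > 0\<close>
    by auto
  \<comment> \<open>The summand for \<open>i = 0\<close> is positive, so the family has the two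
    members that a positive minimum distance requires.\<close>
  have "q ^ (k + r + 0 * k) \<le> (\<Sum>i<m. q ^ (k + r + i * k))"
    using \<open>m > 0\<close> by (intro member_le_sum) auto
  moreover have "q ^ (k + r + 0 * k) > 0"
    using q by simp
  ultimately have "card S \<ge> 2"
    using cardS by linarith
  then have "card S \<le> max_ODFC_size TYPE('a) TYPE('n) A"
    using assms(6) S by (intro card_nested_spread_family_le_max_ODFC_size[OF assms(2,4,3,5)]) auto
  moreover have "real (card S) = (real q ^ n - real q ^ (k + r)) / (real q ^ k - 1) + 1"
  proof -
    have "real q ^ k > 1"
      using q assms(3) by (intro one_less_power) auto
    then show ?thesis
      using geometric_sum_steps[of "real q" k r m] cardS n by (simp add: field_simps)
  qed
  ultimately show ?thesis
    by (metis of_nat_le_iff)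
qed

end
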